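(* Let $n$ be odd. Suppose $(A',B')$, with $|A'|=k$ and $|B'|=\ell$, and $(C',D')$ are equivalent strongly symmetric near-factorizations of $D_n$ with $C'=f_{i,j}(A')h$ and $D'=h^{-1}f_{i,j}(B')$, where $f_{i,j}\in\mathrm{Aut}(D_n)$ and $h\in D_n$. Suppose that $\gcd(n,(k+1)/2)=\gcd(n,(\ell+1)/2)=1$. Let $(A,B)$ and $(C,D)$ be obtained from $(A',B')$ and $(C',D')$, respectively, by applying the inverse Pêcher transform. Then $(A,B)$ and $(C,D)$ are equivalent symmetric near-factorizations of $\mathbb{Z}_{2n}$.
   Context: For $n>2$, $D_n = \langle a,b : a^2 = b^n = abab = e\rangle$ is the dihedral group of order $2n$, with elements $a^ib^j$, $i\in\{0,1\}$, $0\le j\le n-1$ (exponents of $b$ modulo $n$). For $\gcd(i,n)=1$ and $0\le j\le n-1$, $f_{i,j}$ is the automorphism of $D_n$ with $f_{i,j}(a)=ab^j$, $f_{i,j}(b)=b^i$; these are all the automorphisms of $D_n$. A near-factorization of a finite multiplicative group $G$ with identity $e$ is a pair $(A,B)$ of subsets with $|A|\cdot|B|=|G|-1$ and $AB=\{gh: g\in A,h\in B\}=G\setminus\{e\}$; for an additive group the second condition is $A+B=G\setminus\{0\}$. (In $D_n$, $k\ell=2n-1$, so $k$ and $\ell$ are odd.) Two near-factorizations $(A,B)$, $(A_1,B_1)$ of $G$ are equivalent if $(A_1,B_1)=(f(A)h,\,h^{-1}f(B))$ for some $f\in\mathrm{Aut}(G)$, $h\in G$ (additively: $(f(A)+h,\,-h+f(B))$).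 A subset $X$ of an additive group is symmetric if $X=-X$, and $(A,B)$ is symmetric if both $A$ and $B$ are. A subset $X\subseteq D_n$ is strongly symmetric if $a^ib^j\in X \iff a^ib^{-j}\in X$ for $i=0,1$ and all $j$; a near-factorization $(A,B)$ of $D_n$ is strongly symmetric if both $A$ and $B$ are. Inverse Pêcher transform ($n$ odd): let $\phi:\mathbb{Z}_{2n}\to\mathbb{Z}_2\times\mathbb{Z}_n$ be the group isomorphism $\phi(x)=(x \bmod 2, x\bmod n)$ and $\psi:\mathbb{Z}_2\times\mathbb{Z}_n\to D_n$ the bijection $\psi(i,j)=a^ib^j$; the inverse Pêcher transform of a pair $(A',B')$ of subsets of $D_n$ is $(\phi^{-1}(\psi^{-1}(A')),\phi^{-1}(\psi^{-1}(B')))$. *)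

theory Defs
  imports "HOL-Algebra.Elementary_Groups"
begin

section \<open>The dihedral group\<close>

text \<open>
  The pair \<open>(i, j)\<close> stands for the normal form \<open>a^i b^j\<close> of an element of
  \<open>\<langle>a, b | a^2 = b^n = abab = e\<rangle>\<close>; as \<open>b^j a = a b^-j\<close>, moving \<open>a^i'\<close> to the left
  past \<open>b^j\<close> negates \<open>j\<close> when \<open>i' = 1\<close>.  The lemmas below show that this is the
  group with the given presentation.
\<close>

definition dihedral :: "nat \<Rightarrow> (int \<times> int) monoid" where
  "dihedral n =
    \<lparr>carrier = {0..<2} \<times> {0..<int n},
     monoid.mult = (\<lambda>(i, j) (i', j'). ((i + i') mod 2, ((if i' = 0 then j else - j) + j') mod int n)),
     one = (0, 0)\<rparr>"

definition dih_a :: "nat \<Rightarrow> int \<times> int" where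
  "dih_a n = (1, 0)"

definition dih_b :: "nat \<Rightarrow> int \<times> int" where
  "dih_b n = (0, 1 mod int n)"

definition dih_elt :: "nat \<Rightarrow> int \<Rightarrow> int \<Rightarrow> int \<times> int" where
  "dih_elt n i j = dih_a n [^]\<^bsub>dihedral n\<^esub> i \<otimes>\<^bsub>dihedral n\<^esub> dih_b n [^]\<^bsub>dihedral n\<^esub> j"

lemma carrier_dihedral: "carrier (dihedral n) = {0..<2} \<times> {0..<int n}"
  and mult_dihedral: "(i, j) \<otimes>\<^bsub>dihedral n\<^esub> (i', j') =
    ((i + i') mod 2, ((if i' = 0 then j else - j) + j') mod int n)"
  and one_dihedral: "\<one>\<^bsub>dihedral n\<^esub> = (0, 0)"
  by (simp_all add: dihedral_def)

lemma int_cases_two: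
  fixes i :: int
  assumes "0 \<le> i" "i < 2"
  obtains "i = 0" | "i = 1"
  using assms by linarith

lemma group_dihedral:
  assumes "n > 0"
  shows "group (dihedral n)"
proof (rule groupI)
  fix x y assume "x \<in> carrier (dihedral n)" "y \<in> carrier (dihedral n)"
  then show "x \<otimes>\<^bsub>dihedral n\<^esub> y \<in> carrier (dihedral n)"
    using assms by (cases x; cases y) (simp add: carrier_dihedral mult_dihedral)
next
  show "\<one>\<^bsub>dihedral n\<^esub> \<in> carrier (dihedral n)"
    using assms by (simp add: carrier_dihedral one_dihedral)
next
  fix x y z
  assume "x \<in> carrier (dihedral n)" "y \<in> carrier (dihedral n)" "z \<in> carrier (dihedral n)"
  moreover obtain i j i' j' i'' j'' where "x = (i, j)" "y = (i', j')" "z = (i'', j'')"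
    by (cases x; cases y; cases z)
  ultimately show "x \<otimes>\<^bsub>dihedral n\<^esub> y \<otimes>\<^bsub>dihedral n\<^esub> z = x \<otimes>\<^bsub>dihedral n\<^esub> (y \<otimes>\<^bsub>dihedral n\<^esub> z)"
    by (auto simp: carrier_dihedral mult_dihedral mod_simps algebra_simps elim!: int_cases_two)
next
  fix x assume "x \<in> carrier (dihedral n)"
  then show "\<one>\<^bsub>dihedral n\<^esub> \<otimes>\<^bsub>dihedral n\<^esub> x = x"
    by (cases x) (simp add: carrier_dihedral mult_dihedral one_dihedral)
next
  fix x assume x: "x \<in> carrier (dihedral n)"
  obtain i j where ij: "x = (i, j)" by (cases x)
  have "(if i = 0 then (0, (- j) mod int n) else (1, j)) \<in> carrier (dihedral n)"
    using x assms by (auto simp: ij carrier_dihedral)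
  moreover have "(if i = 0 then (0, (- j) mod int n) else (1, j)) \<otimes>\<^bsub>dihedral n\<^esub> x = \<one>\<^bsub>dihedral n\<^esub>"
    using x by (auto simp: ij carrier_dihedral mult_dihedral one_dihedral mod_simps elim!: int_cases_two)
  ultimately show "\<exists>y\<in>carrier (dihedral n). y \<otimes>\<^bsub>dihedral n\<^esub> x = \<one>\<^bsub>dihedral n\<^esub>"
    by blast
qed

lemma order_dihedral: "order (dihedral n) = 2 * n"
  by (simp add: order_def carrier_dihedral)

lemma dih_a_closed: "n > 0 \<Longrightarrow> dih_a n \<in> carrier (dihedral n)"
  and dih_b_closed: "n > 0 \<Longrightarrow> dih_b n \<in> carrier (dihedral n)"
  by (simp_all add: dih_a_def dih_b_def carrier_dihedral)

lemma dih_b_nat_pow: "dih_b n [^]\<^bsub>dihedral n\<^esub> (k::nat) = (0, int k mod int n)"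
  by (induction k)
    (simp_all add: nat_pow_def one_dihedral dih_b_def mult_dihedral mod_simps add.commute)

lemma dih_b_int_pow:
  assumes "n > 0"
  shows "dih_b n [^]\<^bsub>dihedral n\<^esub> (j::int) = (0, j mod int n)"
proof (cases "j < 0")
  case True
  have "inv\<^bsub>dihedral n\<^esub> (0, (- j) mod int n) = (0, j mod int n)"
    by (rule group.inv_equality[OF group_dihedral[OF assms]])
      (use assms in \<open>simp_all add: carrier_dihedral mult_dihedral one_dihedral mod_simps\<close>)
  then show ?thesis using True by (simp add: int_pow_def2 dih_b_nat_pow)
qed (simp add: int_pow_def2 dih_b_nat_pow)

lemma dih_elt_eq:
  assumes "(i, j) \<in> carrier (dihedral n)"
  shows "dih_elt n i j = (i, j)"
proof -
  have n: "n > 0" using assms by (auto simp: carrier_dihedral intro: gr0I)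
  interpret group "dihedral n" by (rule group_dihedral[OF n])
  have i: "i = 0 \<or> i = 1" using assms by (auto simp: carrier_dihedral)
  have "dih_a n [^]\<^bsub>dihedral n\<^esub> i = (i, 0)"
    using i dih_a_closed[OF n] by (auto simp: one_dihedral) (simp add: dih_a_def)
  then show ?thesis
    using assms i by (auto simp: dih_elt_def dih_b_int_pow[OF n] mult_dihedral carrier_dihedral)
qed

lemma dihedral_relations:
  assumes "n > 0"
  shows "dih_a n [^]\<^bsub>dihedral n\<^esub> (2::nat) = \<one>\<^bsub>dihedral n\<^esub>"
    and "dih_b n [^]\<^bsub>dihedral n\<^esub> n = \<one>\<^bsub>dihedral n\<^esub>"
    and "dih_a n \<otimes>\<^bsub>dihedral n\<^esub> dih_b n \<otimes>\<^bsub>dihedral n\<^esub> dih_a n \<otimes>\<^bsub>dihedral n\<^esub> dih_b n = \<one>\<^bsub>dihedral n\<^esub>"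
proof -
  show "dih_a n [^]\<^bsub>dihedral n\<^esub> (2::nat) = \<one>\<^bsub>dihedral n\<^esub>"
    by (simp add: numeral_2_eq_2 nat_pow_def dih_a_def mult_dihedral one_dihedral)
  show "dih_b n [^]\<^bsub>dihedral n\<^esub> n = \<one>\<^bsub>dihedral n\<^esub>"
    by (simp add: dih_b_nat_pow one_dihedral)
qed (simp add: dih_a_def dih_b_def mult_dihedral one_dihedral mod_simps)

lemma dihedral_universal:
  assumes n: "n > 0" and H: "group H" and x: "x \<in> carrier H" and y: "y \<in> carrier H"
    and rel: "x [^]\<^bsub>H\<^esub> (2::nat) = \<one>\<^bsub>H\<^esub>" "y [^]\<^bsub>H\<^esub> n = \<one>\<^bsub>H\<^esub>"
      "x \<otimes>\<^bsub>H\<^esub> y \<otimes>\<^bsub>H\<^esub> x \<otimes>\<^bsub>H\<^esub> y = \<one>\<^bsub>H\<^esub>"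
  shows "\<exists>f \<in> hom (dihedral n) H. f (dih_a n) = x \<and> f (dih_b n) = y"
proof -
  interpret H: group H by (rule H)
  have xx: "x \<otimes>\<^bsub>H\<^esub> x = \<one>\<^bsub>H\<^esub>"
    using rel(1) x by (simp add: numeral_2_eq_2)
  have ymod: "y [^]\<^bsub>H\<^esub> (j mod int n) = y [^]\<^bsub>H\<^esub> j" for j :: int
  proof -
    have "y [^]\<^bsub>H\<^esub> j = y [^]\<^bsub>H\<^esub> (int n * (j div int n) + j mod int n)" by simp
    also have "\<dots> = (y [^]\<^bsub>H\<^esub> int n) [^]\<^bsub>H\<^esub> (j div int n) \<otimes>\<^bsub>H\<^esub> y [^]\<^bsub>H\<^esub> (j mod int n)"
      using y by (simp only: H.int_pow_mult H.int_pow_pow)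
    also have "\<dots> = y [^]\<^bsub>H\<^esub> (j mod int n)"
      using y rel(2) by (simp add: int_pow_int)
    finally show ?thesis by simp
  qed
  have invx: "inv\<^bsub>H\<^esub> x = x" using xx x by (simp add: H.inv_equality)
  have "x \<otimes>\<^bsub>H\<^esub> y \<otimes>\<^bsub>H\<^esub> x = inv\<^bsub>H\<^esub> y"
    using rel(3) x y by (simp add: H.inv_equality)
  then have conj: "x \<otimes>\<^bsub>H\<^esub> y = inv\<^bsub>H\<^esub> y \<otimes>\<^bsub>H\<^esub> x"
    using x y xx by (metis H.inv_closed H.inv_solve_right' H.m_closed invx)
  have xy: "x \<otimes>\<^bsub>H\<^esub> y [^]\<^bsub>H\<^esub> k = y [^]\<^bsub>H\<^esub> (- int k) \<otimes>\<^bsub>H\<^esub> x" for k :: nat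
  proof (induction k)
    case (Suc k)
    have "x \<otimes>\<^bsub>H\<^esub> y [^]\<^bsub>H\<^esub> Suc k = y [^]\<^bsub>H\<^esub> (- int k) \<otimes>\<^bsub>H\<^esub> (x \<otimes>\<^bsub>H\<^esub> y)"
      using Suc x y by (simp add: H.m_assoc flip: H.m_assoc)
    also have "\<dots> = y [^]\<^bsub>H\<^esub> (- int k) \<otimes>\<^bsub>H\<^esub> y [^]\<^bsub>H\<^esub> (- 1 :: int) \<otimes>\<^bsub>H\<^esub> x"
      using x y by (simp add: conj H.m_assoc H.int_pow_neg)
    also have "\<dots> = y [^]\<^bsub>H\<^esub> (- int (Suc k)) \<otimes>\<^bsub>H\<^esub> x"
      using y by (simp add: algebra_simps flip: H.int_pow_mult)
    finally show ?case .
  qed (use x in simp)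
  have yx: "y [^]\<^bsub>H\<^esub> j \<otimes>\<^bsub>H\<^esub> x = x \<otimes>\<^bsub>H\<^esub> y [^]\<^bsub>H\<^esub> (- j)" for j :: int
  proof -
    have "y [^]\<^bsub>H\<^esub> (- j) = y [^]\<^bsub>H\<^esub> nat ((- j) mod int n)"
      using n ymod[of "- j"] by (metis int_nat_eq int_pow_int pos_mod_sign of_nat_0_less_iff)
    moreover have "y [^]\<^bsub>H\<^esub> (- int (nat ((- j) mod int n))) = y [^]\<^bsub>H\<^esub> j"
      using n ymod[of "- ((- j) mod int n)"] ymod[of j] by (simp add: mod_simps)
    ultimately show ?thesis using xy[of "nat ((- j) mod int n)"] by simp
  qed
  let ?f = "\<lambda>(i, j). x [^]\<^bsub>H\<^esub> (i::int) \<otimes>\<^bsub>H\<^esub> y [^]\<^bsub>H\<^esub> (j::int)"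
  have "?f \<in> hom (dihedral n) H"
  proof (rule homI)
    fix p assume "p \<in> carrier (dihedral n)"
    then show "?f p \<in> carrier H" using x y by (cases p) simp
  next
    fix p q assume pq: "p \<in> carrier (dihedral n)" "q \<in> carrier (dihedral n)"
    obtain i j i' j' where *: "p = (i, j)" "q = (i', j')" by (cases p; cases q)
    have i: "i = 0 \<or> i = 1" and i': "i' = 0 \<or> i' = 1" using pq by (auto simp: * carrier_dihedral)
    have cancel: "x \<otimes>\<^bsub>H\<^esub> (x \<otimes>\<^bsub>H\<^esub> z) = z" if "z \<in> carrier H" for z
      using xx x that by (simp flip: H.m_assoc)
    have yxz: "y [^]\<^bsub>H\<^esub> j \<otimes>\<^bsub>H\<^esub> (x \<otimes>\<^bsub>H\<^esub> z) = x \<otimes>\<^bsub>H\<^esub> (y [^]\<^bsub>H\<^esub> (- j) \<otimes>\<^bsub>H\<^esub> z)" if "z \<in> carrier H" for z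
    proof -
      have "y [^]\<^bsub>H\<^esub> j \<otimes>\<^bsub>H\<^esub> (x \<otimes>\<^bsub>H\<^esub> z) = (y [^]\<^bsub>H\<^esub> j \<otimes>\<^bsub>H\<^esub> x) \<otimes>\<^bsub>H\<^esub> z"
        using x y that by (simp add: H.m_assoc)
      then show ?thesis using x y that by (simp only: yx) (simp add: H.m_assoc)
    qed
    have sub: "y [^]\<^bsub>H\<^esub> (j' - j) = y [^]\<^bsub>H\<^esub> (- j) \<otimes>\<^bsub>H\<^esub> y [^]\<^bsub>H\<^esub> j'"
      using y by (simp flip: H.int_pow_mult)
    show "?f (p \<otimes>\<^bsub>dihedral n\<^esub> q) = ?f p \<otimes>\<^bsub>H\<^esub> ?f q"
      unfolding * using i i' x y
      by (elim disjE)
        (simp_all add: mult_dihedral ymod H.int_pow_mult H.m_assoc yxz cancel sub)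
  qed
  moreover have "?f (dih_a n) = x" "?f (dih_b n) = y"
    using x y by (simp_all add: dih_a_def dih_b_def ymod)
  ultimately show ?thesis by blast
qed

section \<open>Near-factorizations\<close>

text \<open>Additive groups are written in the multiplicative notation of \<open>monoid\<close>.\<close>

definition near_factorization :: "('a, 'm) monoid_scheme \<Rightarrow> 'a set \<Rightarrow> 'a set \<Rightarrow> bool" where
  "near_factorization G A B \<longleftrightarrow>
    A \<subseteq> carrier G \<and> B \<subseteq> carrier G \<and>
    card A * card B = order G - 1 \<and>
    A <#>\<^bsub>G\<^esub> B = carrier G - {\<one>\<^bsub>G\<^esub>}"

definition equivalent_nf ::
    "('a, 'm) monoid_scheme \<Rightarrow> 'a set \<Rightarrow> 'a set \<Rightarrow> 'a set \<Rightarrow> 'a set \<Rightarrow> bool" where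
  "equivalent_nf G A B C D \<longleftrightarrow>
    (\<exists>f \<in> iso G G. \<exists>h \<in> carrier G.
      C = (f ` A) #>\<^bsub>G\<^esub> h \<and> D = (inv\<^bsub>G\<^esub> h) <#\<^bsub>G\<^esub> (f ` B))"

definition symmetric_nf :: "('a, 'm) monoid_scheme \<Rightarrow> 'a set \<Rightarrow> 'a set \<Rightarrow> bool" where
  "symmetric_nf G A B \<longleftrightarrow>
    near_factorization G A B \<and> A = (\<lambda>x. inv\<^bsub>G\<^esub> x) ` A \<and> B = (\<lambda>x. inv\<^bsub>G\<^esub> x) ` B"

definition strongly_symmetric :: "nat \<Rightarrow> (int \<times> int) set \<Rightarrow> bool" where
  "strongly_symmetric n X \<longleftrightarrow>
    (\<forall>i \<in> {0, 1}. \<forall>j. dih_elt n i j \<in> X \<longleftrightarrow> dih_elt n i (- j) \<in> X)"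

definition strongly_symmetric_nf :: "nat \<Rightarrow> (int \<times> int) set \<Rightarrow> (int \<times> int) set \<Rightarrow> bool" where
  "strongly_symmetric_nf n A B \<longleftrightarrow>
    near_factorization (dihedral n) A B \<and> strongly_symmetric n A \<and> strongly_symmetric n B"

section \<open>The inverse Pecher transform\<close>

definition pecher_phi :: "nat \<Rightarrow> int \<Rightarrow> int \<times> int" where
  "pecher_phi n x = (x mod 2, x mod int n)"

definition pecher_psi :: "nat \<Rightarrow> int \<times> int \<Rightarrow> int \<times> int" where
  "pecher_psi n = (\<lambda>(i, j). dih_elt n i j)"

definition inv_pecher_set :: "nat \<Rightarrow> (int \<times> int) set \<Rightarrow> int set" where
  "inv_pecher_set n X =
    pecher_phi n -` (pecher_psi n -` X \<inter> carrier (integer_mod_group 2 \<times>\<times> integer_mod_group n))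
      \<inter> carrier (integer_mod_group (2 * n))"

definition inv_pecher :: "nat \<Rightarrow> (int \<times> int) set \<times> (int \<times> int) set \<Rightarrow> int set \<times> int set" where
  "inv_pecher n = (\<lambda>(A', B'). (inv_pecher_set n A', inv_pecher_set n B'))"

end

theory Submission
  imports Defs
begin

text \<open>
  If \<open>X\<close> is strongly symmetric, then \<open>XY\<close> computed in the dihedral group and \<open>X + Y\<close> computed in
  \<open>Z_2 \<times> Z_n\<close> are the same set of pairs, so the inverse transform of a strongly symmetric
  near-factorization is a symmetric near-factorization.

  For the equivalence, write \<open>h = a^u b^v\<close>.  The map \<open>f\<close> followed by the translation by \<open>h\<close> acts
  on the rotations and on the reflections as an affine map \<open>t \<mapsto> \<plusminus> i t + d\<close>.  A symmetric subset of
  \<open>Z_n\<close> has sum \<open>0\<close> for odd \<open>n\<close>; if its image under the affine map is symmetric too, then \<open>n\<close>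
  divides \<open>d\<close> times its cardinality.  The sign character of the dihedral group shows that
  \<open>(a0 - a1) (b0 - b1) = -1\<close> for the numbers of rotations and reflections in \<open>A'\<close> and \<open>B'\<close>, so
  one of \<open>a0, a1\<close> is \<open>(k + 1) / 2\<close> and, on the other side, one of \<open>b1, b0\<close> is \<open>(l + 1) / 2\<close>.
  The coprimality assumptions then force \<open>v = j = 0\<close>, and what remains is \<open>(s, t) \<mapsto> (s + u, i t)\<close>,
  an automorphism of \<open>Z_2 \<times> Z_n\<close> followed by a translation by an element of order at most two.
\<close>

lemma pecher_phi_closed: "n > 0 \<Longrightarrow> pecher_phi n x \<in> carrier (dihedral n)"
  by (simp add: pecher_phi_def carrier_dihedral)

lemma inv_pecher_set_eq:
  assumes "n > 0"
  shows "inv_pecher_set n X = {x \<in> carrier (integer_mod_group (2 * n)). pecher_phi n x \<in> X}"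
  using assms
  by (auto simp: inv_pecher_set_def pecher_psi_def dih_elt_eq pecher_phi_def carrier_dihedral
      carrier_integer_mod_group)

lemma pecher_phi_mod:
  "pecher_phi n (x mod (2 * int n)) = pecher_phi n x"
  by (simp add: pecher_phi_def mod_mod_cancel)

lemma bij_betw_pecher_phi:
  assumes "odd n"
  shows "bij_betw (pecher_phi n) (carrier (integer_mod_group (2 * n))) (carrier (dihedral n))"
proof -
  have n: "n > 0" using assms by (simp add: odd_pos)
  have car: "carrier (integer_mod_group (2 * n)) = {0..<2 * int n}"
    using n by (simp add: carrier_integer_mod_group)
  have "inj_on (pecher_phi n) {0..<2 * int n}"
  proof (rule inj_onI)
    fix x y assume xy: "x \<in> {0..<2 * int n}" "y \<in> {0..<2 * int n}"
      and "pecher_phi n x = pecher_phi n y"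
    then have "2 dvd x - y" "int n dvd x - y"
      by (simp_all add: pecher_phi_def mod_eq_dvd_iff)
    moreover have "coprime 2 (int n)" using assms by simp
    ultimately have "2 * int n dvd x - y" by (simp add: divides_mult)
    then have "x mod (2 * int n) = y mod (2 * int n)" by (simp add: mod_eq_dvd_iff)
    then show "x = y" using xy by simp
  qed
  moreover have "p \<in> pecher_phi n ` {0..<2 * int n}" if p: "p \<in> carrier (dihedral n)" for p
  proof -
    obtain s t where st: "p = (s, t)" "s = 0 \<or> s = 1" "0 \<le> t" "t < int n"
      using p by (cases p) (auto simp: carrier_dihedral elim: int_cases_two)
    define x where "x = (if t mod 2 = s then t else t + int n)"
    have "(t + int n) mod 2 = s" if "t mod 2 \<noteq> s"
      using that st(2) assms by presburger
    then have "pecher_phi n x = p" "x \<in> {0..<2 * int n}"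
      using st by (auto simp: x_def pecher_phi_def)
    then show ?thesis by blast
  qed
  ultimately show ?thesis
    using pecher_phi_closed[OF n] by (auto simp: bij_betw_def car)
qed

lemma card_inv_pecher_set:
  assumes "odd n" and "X \<subseteq> carrier (dihedral n)"
  shows "card (inv_pecher_set n X) = card X"
proof -
  have n: "n > 0" using assms by (simp add: odd_pos)
  have "pecher_phi n ` inv_pecher_set n X = X"
    using assms(2) bij_betw_imp_surj_on[OF bij_betw_pecher_phi[OF assms(1)]]
    by (fastforce simp: inv_pecher_set_eq[OF n])
  moreover have "inj_on (pecher_phi n) (inv_pecher_set n X)"
    using bij_betw_imp_inj_on[OF bij_betw_pecher_phi[OF assms(1)]]
    by (rule inj_on_subset) (auto simp: inv_pecher_set_eq[OF n])
  ultimately show ?thesis by (metis card_image)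
qed

lemma strongly_symmetricD:
  assumes "n > 0" and "strongly_symmetric n X" and "(s, t) \<in> X" and "X \<subseteq> carrier (dihedral n)"
  shows "(s, (- t) mod int n) \<in> X"
proof -
  have st: "(s, t) \<in> carrier (dihedral n)" using assms by blast
  then have c: "(s, (- t) mod int n) \<in> carrier (dihedral n)"
    using assms(1) by (simp add: carrier_dihedral)
  have "s = 0 \<or> s = 1" using st by (auto simp: carrier_dihedral)
  then have "dih_elt n s (- t) \<in> X"
    using assms dih_elt_eq[OF st] by (auto simp: strongly_symmetric_def)
  moreover have "dih_elt n s (- t) = dih_elt n s ((- t) mod int n)"
    using assms(1) by (simp add: dih_elt_def dih_b_int_pow)
  ultimately show ?thesis by (simp add: dih_elt_eq[OF c])
qed

lemma strongly_symmetric_uminus_iff: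
  assumes "n > 0" and "strongly_symmetric n X" and "X \<subseteq> carrier (dihedral n)"
  shows "(s, (- t) mod int n) \<in> X \<longleftrightarrow> (s, t mod int n) \<in> X"
  using strongly_symmetricD[OF assms(1,2) _ assms(3), of s "t mod int n"]
    strongly_symmetricD[OF assms(1,2) _ assms(3), of s "(- t) mod int n"]
  by (auto simp: mod_simps)

lemma inv_pecher_set_mult:
  assumes "odd n" and "strongly_symmetric n X" and "X \<subseteq> carrier (dihedral n)"
    and "Y \<subseteq> carrier (dihedral n)"
  shows "inv_pecher_set n (X <#>\<^bsub>dihedral n\<^esub> Y) =
    inv_pecher_set n X <#>\<^bsub>integer_mod_group (2 * n)\<^esub> inv_pecher_set n Y"
proof -
  have n: "n > 0" using assms by (simp add: odd_pos)
  let ?Z = "carrier (integer_mod_group (2 * n))"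
  have car: "?Z = {0..<2 * int n}"
    using n by (simp add: carrier_integer_mod_group)
  note bij = bij_betw_pecher_phi[OF assms(1)]
  note iff = strongly_symmetric_uminus_iff[OF n assms(2,3)]
  \<comment> \<open>Replacing \<open>(s, t)\<close> by \<open>(s, -t)\<close> in the left factor turns the dihedral product into the sum.\<close>
  have flip: "\<exists>x' \<in> ?Z. (pecher_phi n x' \<in> X \<longleftrightarrow> pecher_phi n x \<in> X) \<and>
      pecher_phi n x' \<otimes>\<^bsub>dihedral n\<^esub> pecher_phi n y = pecher_phi n (x + y) \<and>
      pecher_phi n x \<otimes>\<^bsub>dihedral n\<^esub> pecher_phi n y = pecher_phi n (x' + y)" for x y
  proof -
    define p where "p = (x mod 2, (if y mod 2 = 0 then x else - x) mod int n)"
    have "p \<in> pecher_phi n ` ?Z"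
      using n bij_betw_imp_surj_on[OF bij] by (simp add: p_def carrier_dihedral)
    then obtain x' where x': "x' \<in> ?Z" "pecher_phi n x' = p" by blast
    have x'm: "x' mod 2 = x mod 2" "x' mod int n = (if y mod 2 = 0 then x else - x) mod int n"
      using x'(2) by (auto simp: pecher_phi_def p_def)
    have e2: "(x' + y) mod 2 = (x + y) mod 2"
      using x'm(1) by (metis mod_add_left_eq)
    have en: "(x' + y) mod int n = ((if y mod 2 = 0 then x else - x) + y) mod int n"
      using x'm(2) by (metis mod_add_left_eq)
    have "pecher_phi n x' \<otimes>\<^bsub>dihedral n\<^esub> pecher_phi n y = pecher_phi n (x + y)"
      by (simp add: x'(2)) (auto simp: p_def pecher_phi_def mult_dihedral mod_simps add.commute)
    moreover have "pecher_phi n x \<otimes>\<^bsub>dihedral n\<^esub> pecher_phi n y = pecher_phi n (x' + y)"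
      using e2 en by (auto simp: pecher_phi_def mult_dihedral mod_simps)
    moreover have "pecher_phi n x' \<in> X \<longleftrightarrow> pecher_phi n x \<in> X"
      by (simp add: x'(2)) (auto simp: p_def pecher_phi_def iff)
    ultimately show ?thesis using x'(1) by blast
  qed
  show ?thesis
  proof (intro Set.set_eqI iffI)
    fix z assume "z \<in> inv_pecher_set n (X <#>\<^bsub>dihedral n\<^esub> Y)"
    then obtain p q where z: "z \<in> ?Z" and pq: "p \<in> X" "q \<in> Y"
      and e: "pecher_phi n z = p \<otimes>\<^bsub>dihedral n\<^esub> q"
      by (auto simp: inv_pecher_set_eq[OF n] set_mult_def)
    have "p \<in> pecher_phi n ` ?Z" "q \<in> pecher_phi n ` ?Z"
      using pq assms(3,4) bij_betw_imp_surj_on[OF bij] by auto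
    then obtain x y where x: "x \<in> ?Z" "p = pecher_phi n x" and y: "y \<in> ?Z" "q = pecher_phi n y"
      by blast
    obtain x' where x': "x' \<in> ?Z" "pecher_phi n x' \<in> X"
      "p \<otimes>\<^bsub>dihedral n\<^esub> q = pecher_phi n (x' + y)"
      using flip[of x y] pq x y by auto
    have "pecher_phi n z = pecher_phi n ((x' + y) mod (2 * int n))"
      using e x' by (simp add: pecher_phi_mod)
    moreover have "(x' + y) mod (2 * int n) \<in> ?Z" using n by (simp add: car)
    ultimately have "z = (x' + y) mod (2 * int n)"
      using z bij_betw_imp_inj_on[OF bij] by (auto dest: inj_onD)
    then show "z \<in> inv_pecher_set n X <#>\<^bsub>integer_mod_group (2 * n)\<^esub> inv_pecher_set n Y"
      using x' y pq by (auto simp: inv_pecher_set_eq[OF n] set_mult_def mult_integer_mod_group)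
  next
    fix z assume "z \<in> inv_pecher_set n X <#>\<^bsub>integer_mod_group (2 * n)\<^esub> inv_pecher_set n Y"
    then obtain x y where xy: "pecher_phi n x \<in> X" "pecher_phi n y \<in> Y"
      and z: "z = (x + y) mod (2 * int n)"
      by (auto simp: inv_pecher_set_eq[OF n] set_mult_def mult_integer_mod_group)
    obtain x' where "pecher_phi n x' \<in> X"
      "pecher_phi n x' \<otimes>\<^bsub>dihedral n\<^esub> pecher_phi n y = pecher_phi n z"
      using flip[of x y] xy by (auto simp: z pecher_phi_mod)
    moreover have "z \<in> ?Z" using n by (simp add: car z)
    ultimately show "z \<in> inv_pecher_set n (X <#>\<^bsub>dihedral n\<^esub> Y)"
      using xy by (force simp: inv_pecher_set_eq[OF n] set_mult_def)
  qed
qed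

lemma inv_pecher_set_symmetric:
  assumes "n > 0" and "strongly_symmetric n X" and "X \<subseteq> carrier (dihedral n)"
  shows "inv_pecher_set n X = (\<lambda>x. inv\<^bsub>integer_mod_group (2 * n)\<^esub> x) ` inv_pecher_set n X"
proof -
  interpret Z: group "integer_mod_group (2 * n)" by simp
  have "inv\<^bsub>integer_mod_group (2 * n)\<^esub> x \<in> inv_pecher_set n X" if "x \<in> inv_pecher_set n X" for x
  proof -
    have x: "x \<in> carrier (integer_mod_group (2 * n))" "pecher_phi n x \<in> X"
      using that by (auto simp: inv_pecher_set_eq[OF assms(1)])
    moreover have "(- x) mod 2 = x mod 2" by presburger
    ultimately have "pecher_phi n (inv\<^bsub>integer_mod_group (2 * n)\<^esub> x) = (x mod 2, (- x) mod int n)"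
      by (simp add: pecher_phi_mod) (simp add: pecher_phi_def)
    then show ?thesis
      using x strongly_symmetric_uminus_iff[OF assms] Z.inv_closed[OF x(1)]
      by (simp add: inv_pecher_set_eq[OF assms(1)] pecher_phi_def del: inv_integer_mod_group)
  qed
  moreover have "inv\<^bsub>integer_mod_group (2 * n)\<^esub> (inv\<^bsub>integer_mod_group (2 * n)\<^esub> x) = x"
    if "x \<in> inv_pecher_set n X" for x
    using that by (simp add: inv_pecher_set_eq[OF assms(1)] del: inv_integer_mod_group)
  ultimately show ?thesis by (force simp: image_iff)
qed

lemma symmetric_nf_inv_pecher_set:
  assumes "odd n" and nf: "strongly_symmetric_nf n X Y"
  shows "symmetric_nf (integer_mod_group (2 * n)) (inv_pecher_set n X) (inv_pecher_set n Y)"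
proof -
  have n: "n > 0" using assms by (simp add: odd_pos)
  have XY: "strongly_symmetric n X" "strongly_symmetric n Y"
    "X \<subseteq> carrier (dihedral n)" "Y \<subseteq> carrier (dihedral n)"
    "card X * card Y = 2 * n - 1"
    "X <#>\<^bsub>dihedral n\<^esub> Y = carrier (dihedral n) - {\<one>\<^bsub>dihedral n\<^esub>}"
    using nf by (auto simp: strongly_symmetric_nf_def near_factorization_def order_dihedral)
  have "inv_pecher_set n (carrier (dihedral n) - {\<one>\<^bsub>dihedral n\<^esub>}) =
      carrier (integer_mod_group (2 * n)) - {0}"
  proof -
    have "pecher_phi n x = (0, 0) \<longleftrightarrow> x = 0" if "x \<in> carrier (integer_mod_group (2 * n))" for x
      using inj_onD[OF bij_betw_imp_inj_on[OF bij_betw_pecher_phi[OF assms(1)]], of x 0] that n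
      by (auto simp: pecher_phi_def carrier_integer_mod_group)
    then show ?thesis
      using n by (auto simp: inv_pecher_set_eq one_dihedral pecher_phi_closed)
  qed
  then have "inv_pecher_set n X <#>\<^bsub>integer_mod_group (2 * n)\<^esub> inv_pecher_set n Y =
      carrier (integer_mod_group (2 * n)) - {0}"
    by (metis inv_pecher_set_mult[OF assms(1) XY(1,3,4)] XY(6))
  moreover have "order (integer_mod_group (2 * n)) = 2 * n"
    using n by (simp add: order_def carrier_integer_mod_group)
  ultimately show ?thesis
    using XY card_inv_pecher_set[OF assms(1)] inv_pecher_set_symmetric[OF n]
    by (auto simp: symmetric_nf_def near_factorization_def inv_pecher_set_eq[OF n])
qed

lemma near_factorization_bij_betw:
  assumes "near_factorization G A B" and fin: "finite (carrier G)" and "\<one>\<^bsub>G\<^esub> \<in> carrier G"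
  shows "bij_betw (\<lambda>(x, y). x \<otimes>\<^bsub>G\<^esub> y) (A \<times> B) (carrier G - {\<one>\<^bsub>G\<^esub>})"
proof -
  have AB: "A \<subseteq> carrier G" "B \<subseteq> carrier G" "card A * card B = order G - 1"
    "A <#>\<^bsub>G\<^esub> B = carrier G - {\<one>\<^bsub>G\<^esub>}"
    using assms(1) by (auto simp: near_factorization_def)
  have im: "(\<lambda>(x, y). x \<otimes>\<^bsub>G\<^esub> y) ` (A \<times> B) = carrier G - {\<one>\<^bsub>G\<^esub>}"
    unfolding AB(4)[symmetric] set_mult_def by auto
  moreover have "inj_on (\<lambda>(x, y). x \<otimes>\<^bsub>G\<^esub> y) (A \<times> B)"
  proof (rule eq_card_imp_inj_on)
    show "finite (A \<times> B)" using AB fin by (meson finite_SigmaI finite_subset)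
    show "card ((\<lambda>(x, y). x \<otimes>\<^bsub>G\<^esub> y) ` (A \<times> B)) = card (A \<times> B)"
      using AB(3) assms(3) by (simp add: im card_cartesian_product order_def)
  qed
  ultimately show ?thesis by (simp add: bij_betw_def)
qed

lemma near_factorization_character:
  fixes \<chi> :: "'a \<Rightarrow> int"
  assumes "near_factorization G A B" and fin: "finite (carrier G)" and one: "\<one>\<^bsub>G\<^esub> \<in> carrier G"
    and mult: "\<And>x y. x \<in> carrier G \<Longrightarrow> y \<in> carrier G \<Longrightarrow> \<chi> (x \<otimes>\<^bsub>G\<^esub> y) = \<chi> x * \<chi> y"
    and "sum \<chi> (carrier G) = 0"
  shows "sum \<chi> A * sum \<chi> B = - \<chi> \<one>\<^bsub>G\<^esub>"
proof -
  have AB: "A \<subseteq> carrier G" "B \<subseteq> carrier G"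
    using assms(1) by (auto simp: near_factorization_def)
  have "sum \<chi> A * sum \<chi> B = (\<Sum>(x, y) \<in> A \<times> B. \<chi> x * \<chi> y)"
    by (simp add: sum_product sum.cartesian_product)
  also have "\<dots> = (\<Sum>p \<in> A \<times> B. \<chi> ((\<lambda>(x, y). x \<otimes>\<^bsub>G\<^esub> y) p))"
    using AB mult by (intro sum.cong) (auto simp: subset_iff)
  also have "\<dots> = sum \<chi> (carrier G - {\<one>\<^bsub>G\<^esub>})"
    by (rule sum.reindex_bij_betw[OF near_factorization_bij_betw[OF assms(1-3)]])
  also have "\<dots> = - \<chi> \<one>\<^bsub>G\<^esub>"
    using assms(5) sum.remove[OF fin one, of \<chi>] by simp
  finally show ?thesis .
qed

lemma dihedral_card_sign_sum_fibres:
  assumes "X \<subseteq> carrier (dihedral n)"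
  shows "card X = card {t. (0, t) \<in> X} + card {t. (1, t) \<in> X}"
    and "(\<Sum>(s, t) \<in> X. 1 - 2 * s) = int (card {t. (0, t) \<in> X}) - int (card {t. (1, t) \<in> X})"
proof -
  have X: "X = Pair 0 ` {t. (0, t) \<in> X} \<union> Pair 1 ` {t. (1, t) \<in> X}"
    using assms by (force simp: carrier_dihedral elim!: int_cases_two)
  have fin: "finite {t. (s, t) \<in> X}" for s
    by (rule finite_subset[of _ "{0..<int n}"]) (use assms in \<open>auto simp: carrier_dihedral\<close>)
  show "card X = card {t. (0, t) \<in> X} + card {t. (1, t) \<in> X}"
    by (subst X, subst card_Un_disjoint) (auto simp: card_image inj_on_def fin)
  show "(\<Sum>(s, t) \<in> X. 1 - 2 * s) = int (card {t. (0, t) \<in> X}) - int (card {t. (1, t) \<in> X})"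
    by (subst X, subst sum.union_disjoint) (auto simp: sum.reindex inj_on_def fin)
qed

text \<open>Evaluating the sign character, which is \<open>-1\<close> exactly at the reflections.\<close>

lemma near_factorization_dihedral_fibres:
  assumes "n > 0" and nf: "near_factorization (dihedral n) A B"
  shows "(int (card {t. (0, t) \<in> A}) - int (card {t. (1, t) \<in> A})) *
    (int (card {t. (0, t) \<in> B}) - int (card {t. (1, t) \<in> B})) = -1"
proof -
  let ?\<chi> = "\<lambda>(s, t::int). 1 - 2 * s :: int"
  have "sum ?\<chi> A * sum ?\<chi> B = - ?\<chi> \<one>\<^bsub>dihedral n\<^esub>"
  proof (rule near_factorization_character[OF nf])
    show "finite (carrier (dihedral n))" "\<one>\<^bsub>dihedral n\<^esub> \<in> carrier (dihedral n)"
      using assms(1) by (simp_all add: carrier_dihedral one_dihedral)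
    have "{0..<2::int} = {0, 1}" by auto
    then show "sum ?\<chi> (carrier (dihedral n)) = 0"
      by (simp add: carrier_dihedral flip: sum.cartesian_product)
  next
    fix x y assume "x \<in> carrier (dihedral n)" "y \<in> carrier (dihedral n)"
    then show "?\<chi> (x \<otimes>\<^bsub>dihedral n\<^esub> y) = ?\<chi> x * ?\<chi> y"
      by (cases x; cases y) (auto simp: carrier_dihedral mult_dihedral elim!: int_cases_two)
  qed
  moreover have "A \<subseteq> carrier (dihedral n)" "B \<subseteq> carrier (dihedral n)"
    using nf by (auto simp: near_factorization_def)
  ultimately show ?thesis by (simp add: dihedral_card_sign_sum_fibres(2) one_dihedral)
qed

lemma symmetric_sum_dvd:
  fixes X :: "int set"
  assumes "odd n" and "X \<subseteq> {0..<int n}" and "\<And>t. t \<in> X \<Longrightarrow> (- t) mod int n \<in> X"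
  shows "int n dvd \<Sum>X"
proof -
  have invol: "(- ((- t) mod int n)) mod int n = t" if "t \<in> X" for t
    using that assms(2) by (auto simp: mod_simps)
  have "(\<Sum>t\<in>X. (- t) mod int n) = \<Sum>X"
    by (rule sum.reindex_bij_witness[of _ "\<lambda>t. (- t) mod int n" "\<lambda>t. (- t) mod int n"])
      (use assms(3) invol in auto)
  then have "(\<Sum>t\<in>X. - t) mod int n = \<Sum>X mod int n"
    by (metis mod_sum_eq)
  then have "int n dvd 2 * \<Sum>X"
    by (simp add: sum_negf mod_eq_dvd_iff)
  then show ?thesis using assms(1) by (simp add: coprime_dvd_mult_right_iff)
qed

lemma symmetric_affine_image_dvd:
  fixes X :: "int set"
  assumes "odd n" and X: "X \<subseteq> {0..<int n}" and "\<And>t. t \<in> X \<Longrightarrow> (- t) mod int n \<in> X"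
    and c: "coprime c (int n)"
    and Y: "Y = (\<lambda>t. (c * t + d) mod int n) ` X" and "\<And>t. t \<in> Y \<Longrightarrow> (- t) mod int n \<in> Y"
  shows "int n dvd d * int (card X)"
proof -
  have n: "n > 0" using assms by (simp add: odd_pos)
  have inj: "inj_on (\<lambda>t. (c * t + d) mod int n) X"
  proof (rule inj_onI)
    fix x y assume xy: "x \<in> X" "y \<in> X" and "(c * x + d) mod int n = (c * y + d) mod int n"
    then have "int n dvd c * (x - y)" by (simp add: mod_eq_dvd_iff algebra_simps)
    then have "int n dvd x - y"
      using c by (simp add: coprime_dvd_mult_right_iff coprime_commute)
    then have "x mod int n = y mod int n" by (simp add: mod_eq_dvd_iff)
    then show "x = y" using xy X by (auto simp: subset_iff)
  qed
  have "\<Sum>Y = (\<Sum>t\<in>X. (c * t + d) mod int n)" by (simp add: Y sum.reindex[OF inj])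
  then have "\<Sum>Y mod int n = (c * \<Sum>X + d * int (card X)) mod int n"
    by (simp add: mod_sum_eq sum.distrib sum_distrib_left mult.commute)
  moreover have "int n dvd \<Sum>X" by (rule symmetric_sum_dvd[OF assms(1-3)])
  moreover have "int n dvd \<Sum>Y"
    by (rule symmetric_sum_dvd[OF assms(1) _ assms(6)]) (use n in \<open>auto simp: Y\<close>)
  ultimately have "int n dvd c * \<Sum>X + d * int (card X)" by (simp add: dvd_eq_mod_eq_0)
  then show ?thesis using \<open>int n dvd \<Sum>X\<close> by (simp add: dvd_add_right_iff)
qed

lemma strongly_symmetric_affine_image_dvd:
  assumes "odd n" and X: "X \<subseteq> carrier (dihedral n)" and "strongly_symmetric n X"
    and "coprime c (int n)"
    and Y: "Y = (\<lambda>(s, t). ((s + u) mod 2, (c * t + d s) mod int n)) ` X"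
    and "strongly_symmetric n Y" and s: "s = 0 \<or> s = 1"
  shows "int n dvd d s * int (card {t. (s, t) \<in> X})"
proof (rule symmetric_affine_image_dvd[OF assms(1) _ _ assms(4) refl])
  have n: "n > 0" using assms by (simp add: odd_pos)
  show "{t. (s, t) \<in> X} \<subseteq> {0..<int n}" using X by (auto simp: carrier_dihedral)
  show "(- t) mod int n \<in> {t. (s, t) \<in> X}" if "t \<in> {t. (s, t) \<in> X}" for t
    using that strongly_symmetricD[OF n assms(3) _ X] by simp
  have Yc: "Y \<subseteq> carrier (dihedral n)" using n by (auto simp: Y carrier_dihedral)
  have "(s' + u) mod 2 = (s + u) mod 2 \<Longrightarrow> s' = s" if "(s', t) \<in> X" for s' t
  proof -
    have "s' = 0 \<or> s' = 1" using that X by (auto simp: carrier_dihedral)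
    then show "(s' + u) mod 2 = (s + u) mod 2 \<Longrightarrow> s' = s" using s by presburger
  qed
  then have "(\<lambda>t. (c * t + d s) mod int n) ` {t. (s, t) \<in> X} = {t. ((s + u) mod 2, t) \<in> Y}"
    by (force simp: Y)
  then show "(- t) mod int n \<in> (\<lambda>t. (c * t + d s) mod int n) ` {t. (s, t) \<in> X}"
    if "t \<in> (\<lambda>t. (c * t + d s) mod int n) ` {t. (s, t) \<in> X}" for t
    using that strongly_symmetricD[OF n assms(6) _ Yc] by simp
qed

lemma integer_mod_group_mult_iso:
  assumes "N > 0" and "coprime m (int N)"
  shows "(\<lambda>x. (m * x) mod int N) \<in> iso (integer_mod_group N) (integer_mod_group N)"
proof -
  have car: "carrier (integer_mod_group N) = {0..<int N}"
    using assms(1) by (simp add: carrier_integer_mod_group)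
  have "(\<lambda>x. (m * x) mod int N) \<in> hom (integer_mod_group N) (integer_mod_group N)"
    using assms(1) by (auto simp: hom_def car mult_integer_mod_group mod_simps distrib_left)
  moreover have "inj_on (\<lambda>x. (m * x) mod int N) {0..<int N}"
  proof (rule inj_onI)
    fix x y assume xy: "x \<in> {0..<int N}" "y \<in> {0..<int N}"
      and "(m * x) mod int N = (m * y) mod int N"
    then have "int N dvd m * (x - y)" by (simp add: mod_eq_dvd_iff algebra_simps)
    then have "int N dvd x - y"
      using assms(2) by (simp add: coprime_dvd_mult_right_iff coprime_commute)
    then have "x mod int N = y mod int N" by (simp add: mod_eq_dvd_iff)
    then show "x = y" using xy by simp
  qed
  moreover from this have "(\<lambda>x. (m * x) mod int N) ` {0..<int N} = {0..<int N}"
    using assms(1) by (intro endo_inj_surj) auto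
  ultimately show ?thesis by (simp add: iso_def bij_betw_def car)
qed

lemma inv_pecher_set_image:
  assumes "odd n" and X: "X \<subseteq> carrier (dihedral n)"
    and G: "\<And>x. x \<in> carrier (integer_mod_group (2 * n)) \<Longrightarrow> g x \<in> carrier (integer_mod_group (2 * n))"
    and comm: "\<And>x. x \<in> carrier (integer_mod_group (2 * n)) \<Longrightarrow> pecher_phi n (g x) = F (pecher_phi n x)"
  shows "inv_pecher_set n (F ` X) = g ` inv_pecher_set n X"
proof -
  have n: "n > 0" using assms by (simp add: odd_pos)
  let ?Z = "carrier (integer_mod_group (2 * n))"
  note bij = bij_betw_pecher_phi[OF assms(1)]
  have "y \<in> g ` inv_pecher_set n X" if y: "y \<in> ?Z" "pecher_phi n y \<in> F ` X" for y
  proof -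
    from y(2) obtain p where p: "p \<in> X" "pecher_phi n y = F p" by blast
    moreover have "p \<in> pecher_phi n ` ?Z" using p X bij_betw_imp_surj_on[OF bij] by auto
    ultimately obtain x where x: "x \<in> ?Z" "p = pecher_phi n x" by blast
    then have "pecher_phi n y = pecher_phi n (g x)" using p comm by simp
    then have "y = g x" using inj_onD[OF bij_betw_imp_inj_on[OF bij]] y x G by blast
    then show ?thesis using p x by (auto simp: inv_pecher_set_eq[OF n])
  qed
  then show ?thesis using G comm by (auto simp: inv_pecher_set_eq[OF n])
qed

lemma inv_pecher_set_affine:
  assumes "odd n" and X: "X \<subseteq> carrier (dihedral n)" and "odd m" and "m mod int n = i mod int n"
  shows "inv_pecher_set n ((\<lambda>(s, t). ((s + u) mod 2, (i * t) mod int n)) ` X) =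
    (\<lambda>x. (m * x + u * int n) mod (2 * int n)) ` inv_pecher_set n X"
proof (rule inv_pecher_set_image[OF assms(1) X])
  have n: "n > 0" using assms by (simp add: odd_pos)
  fix x
  show "(m * x + u * int n) mod (2 * int n) \<in> carrier (integer_mod_group (2 * n))"
    using n by (simp add: carrier_integer_mod_group)
  have "(m * x + u * int n) mod 2 = (x + u) mod 2"
    using assms(1,3) by (auto simp: mod2_eq_if)
  moreover have "(m * x + u * int n) mod int n = (i * x) mod int n"
    using mod_mult_cong[OF assms(4) refl, of x] by simp
  ultimately show "pecher_phi n ((m * x + u * int n) mod (2 * int n)) =
      (\<lambda>(s, t). ((s + u) mod 2, (i * t) mod int n)) (pecher_phi n x)"
    unfolding pecher_phi_mod by (simp add: pecher_phi_def mod_simps)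
qed

lemma dihedral_hom_apply:
  assumes n: "n > 0" and f: "f \<in> hom (dihedral n) (dihedral n)"
    and a: "f (dih_a n) = dih_a n \<otimes>\<^bsub>dihedral n\<^esub> dih_b n [^]\<^bsub>dihedral n\<^esub> (j::int)"
    and b: "f (dih_b n) = dih_b n [^]\<^bsub>dihedral n\<^esub> (i::int)"
    and st: "(s, t) \<in> carrier (dihedral n)"
  shows "f (s, t) = (s, (i * t + j * s) mod int n)"
proof -
  interpret group "dihedral n" by (rule group_dihedral[OF n])
  interpret f: group_hom "dihedral n" "dihedral n" f
    by unfold_locales (rule f)
  have "f (s, t) = f (dih_a n [^]\<^bsub>dihedral n\<^esub> s \<otimes>\<^bsub>dihedral n\<^esub> dih_b n [^]\<^bsub>dihedral n\<^esub> t)"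
    using dih_elt_eq[OF st] by (simp add: dih_elt_def)
  also have "\<dots> = f (dih_a n) [^]\<^bsub>dihedral n\<^esub> s \<otimes>\<^bsub>dihedral n\<^esub> f (dih_b n) [^]\<^bsub>dihedral n\<^esub> t"
    using dih_a_closed[OF n] dih_b_closed[OF n] by (simp add: f.hom_int_pow)
  also have "f (dih_b n) [^]\<^bsub>dihedral n\<^esub> t = (0, (i * t) mod int n)"
    using dih_b_closed[OF n] by (simp only: b int_pow_pow) (simp add: dih_b_int_pow[OF n])
  also have "f (dih_a n) = (1, j mod int n)"
    by (simp add: a dih_b_int_pow[OF n]) (simp add: dih_a_def mult_dihedral)
  also have "(1, j mod int n) [^]\<^bsub>dihedral n\<^esub> s = (s, (j * s) mod int n)"
  proof -
    have "(1, j mod int n) \<in> carrier (dihedral n)" using n by (simp add: carrier_dihedral)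
    moreover have "s = 0 \<or> s = 1" using st by (auto simp: carrier_dihedral)
    ultimately show ?thesis by (auto simp: one_dihedral)
  qed
  also have "(s, (j * s) mod int n) \<otimes>\<^bsub>dihedral n\<^esub> (0, (i * t) mod int n) =
      (s, (i * t + j * s) mod int n)"
    using st by (simp add: carrier_dihedral mult_dihedral mod_simps add.commute)
  finally show ?thesis .
qed

lemma inv_dihedral:
  assumes "n > 0" and "(u, v) \<in> carrier (dihedral n)"
  shows "inv\<^bsub>dihedral n\<^esub> (u, v) = (u, (if u = 0 then - v else v) mod int n)"
  by (rule group.inv_equality[OF group_dihedral[OF assms(1)]])
    (use assms in \<open>auto simp: carrier_dihedral mult_dihedral one_dihedral mod_simps
      elim!: int_cases_two\<close>)

lemma strongly_symmetric_image_sign: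
  assumes "n > 0" and X: "X \<subseteq> carrier (dihedral n)" and "strongly_symmetric n X"
  shows "(\<lambda>(s, t). ((s + u) mod 2, (- i * t) mod int n)) ` X =
    (\<lambda>(s, t). ((s + u) mod 2, (i * t) mod int n)) ` X" (is "?L ` X = ?R ` X")
proof -
  let ?\<nu> = "\<lambda>(s :: int, t). (s, (- t) mod int n)"
  have \<nu>: "?\<nu> p \<in> X" if "p \<in> X" for p
    using that strongly_symmetricD[OF assms(1,3) _ X] by (cases p) simp
  have "(c * ((- t) mod int n)) mod int n = (- c * t) mod int n" for c t
    by (metis mod_mult_right_eq minus_mult_commute)
  from this[of i] this[of "- i"] have "?L p = ?R (?\<nu> p)" "?R p = ?L (?\<nu> p)" for p
    by (cases p; simp)+
  then show ?thesis using \<nu> by (metis (no_types, lifting) imageI image_subsetI subset_antisym)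
qed

theorem theorem3p11:
  fixes n k l :: nat and i j :: int
    and f :: "int \<times> int \<Rightarrow> int \<times> int" and h :: "int \<times> int"
    and A' B' C' D' :: "(int \<times> int) set" and A B C D :: "int set"
  assumes "n > 2" and "odd n"
    and "strongly_symmetric_nf n A' B'" and "card A' = k" and "card B' = l"
    and "strongly_symmetric_nf n C' D'"
    and "gcd i (int n) = 1" and "0 \<le> j" and "j \<le> int n - 1"
    and "f \<in> iso (dihedral n) (dihedral n)"
    and "f (dih_a n) = dih_a n \<otimes>\<^bsub>dihedral n\<^esub> dih_b n [^]\<^bsub>dihedral n\<^esub> j"
    and "f (dih_b n) = dih_b n [^]\<^bsub>dihedral n\<^esub> i"
    and "h \<in> carrier (dihedral n)"
    and "C' = (f ` A') #>\<^bsub>dihedral n\<^esub> h"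
    and "D' = (inv\<^bsub>dihedral n\<^esub> h) <#\<^bsub>dihedral n\<^esub> (f ` B')"
    and "gcd n ((k + 1) div 2) = 1" and "gcd n ((l + 1) div 2) = 1"
    and "(A, B) = inv_pecher n (A', B')" and "(C, D) = inv_pecher n (C', D')"
  shows "symmetric_nf (integer_mod_group (2 * n)) A B \<and>
         symmetric_nf (integer_mod_group (2 * n)) C D \<and>
         equivalent_nf (integer_mod_group (2 * n)) A B C D"
proof -
  have n: "n > 0" using assms(1) by simp
  have A': "A' \<subseteq> carrier (dihedral n)" "strongly_symmetric n A'"
    and B': "B' \<subseteq> carrier (dihedral n)" "strongly_symmetric n B'"
    and nf: "near_factorization (dihedral n) A' B'"
    and sC: "strongly_symmetric n C'" and sD: "strongly_symmetric n D'"
    using assms(3,6) by (auto simp: strongly_symmetric_nf_def near_factorization_def)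
  obtain u v where h: "h = (u, v)" by (cases h)
  have u: "u = 0 \<or> u = 1" and v: "0 \<le> v" "v < int n"
    using assms(13) by (auto simp: h carrier_dihedral)
  have f: "f (s, t) = (s, (i * t + j * s) mod int n)" if "(s, t) \<in> carrier (dihedral n)" for s t
    using dihedral_hom_apply[OF n _ assms(11,12) that] assms(10) by (simp add: iso_def)
  define \<sigma> :: int where "\<sigma> = (if u = 0 then 1 else - 1)"
  have \<sigma>: "\<sigma> = 1 \<or> \<sigma> = - 1" by (simp add: \<sigma>_def)
  have C': "C' = (\<lambda>(s, t). ((s + u) mod 2, (\<sigma> * i * t + (\<sigma> * j * s + v)) mod int n)) ` A'"
  proof -
    have "C' = (\<lambda>p. f p \<otimes>\<^bsub>dihedral n\<^esub> h) ` A'"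
      by (auto simp: assms(14) r_coset_def)
    also have "\<dots> = (\<lambda>(s, t). ((s + u) mod 2, (\<sigma> * i * t + (\<sigma> * j * s + v)) mod int n)) ` A'"
      using A'(1) by (intro image_cong)
        (auto simp: f h mult_dihedral \<sigma>_def mod_simps algebra_simps subset_iff)
    finally show ?thesis .
  qed
  define d where "d s = (if s = 0 then - \<sigma> * v else j + \<sigma> * v)" for s :: int
  have D': "D' = (\<lambda>(s, t). ((s + u) mod 2, (i * t + d s) mod int n)) ` B'"
  proof -
    have "D' = (\<lambda>p. inv\<^bsub>dihedral n\<^esub> h \<otimes>\<^bsub>dihedral n\<^esub> f p) ` B'"
      by (auto simp: assms(15) l_coset_def)
    also have "\<dots> = (\<lambda>(s, t). ((s + u) mod 2, (i * t + d s) mod int n)) ` B'"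
    proof (intro image_cong refl)
      fix p assume "p \<in> B'"
      then have p: "p \<in> carrier (dihedral n)" using B'(1) by blast
      obtain s t where st: "p = (s, t)" by (cases p)
      have "s = 0 \<or> s = 1" using p by (auto simp: st carrier_dihedral)
      then show "inv\<^bsub>dihedral n\<^esub> h \<otimes>\<^bsub>dihedral n\<^esub> f p =
          (\<lambda>(s, t). ((s + u) mod 2, (i * t + d s) mod int n)) p"
        using p u assms(13) by (auto simp: st h f inv_dihedral[OF n] mult_dihedral d_def \<sigma>_def
            mod_simps algebra_simps)
    qed
    finally show ?thesis .
  qed
  define a0 a1 b0 b1 where "a0 = card {t. (0, t) \<in> A'}" and "a1 = card {t. (1, t) \<in> A'}"
    and "b0 = card {t. (0, t) \<in> B'}" and "b1 = card {t. (1, t) \<in> B'}"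
  have ci: "coprime i (int n)" using assms(7) by (simp add: coprime_iff_gcd_eq_1)
  have c\<sigma>: "coprime (\<sigma> * i) (int n)" using \<sigma> ci by auto
  note dvdA = strongly_symmetric_affine_image_dvd[OF assms(2) A' c\<sigma> C' sC]
  note dvdB = strongly_symmetric_affine_image_dvd[OF assms(2) B' ci D' sD]
  have da0: "int n dvd v * int a0" and da1: "int n dvd (\<sigma> * j + v) * int a1"
    and db0: "int n dvd v * int b0" and db1: "int n dvd (j + \<sigma> * v) * int b1"
    using dvdA[of 0] dvdA[of 1] dvdB[of 0] dvdB[of 1] \<sigma>
    by (auto simp: d_def a0_def a1_def b0_def b1_def)
  have kl: "k = a0 + a1" "l = b0 + b1"
    using assms(4,5) dihedral_card_sign_sum_fibres(1)[OF A'(1)] dihedral_card_sign_sum_fibres(1)[OF B'(1)]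
    by (simp_all add: a0_def a1_def b0_def b1_def)
  have "(int a0 - int a1) * (int b0 - int b1) = -1"
    using near_factorization_dihedral_fibres[OF n nf] by (simp add: a0_def a1_def b0_def b1_def)
  then have "(a0 = a1 + 1 \<and> b1 = b0 + 1) \<or> (a1 = a0 + 1 \<and> b0 = b1 + 1)"
    by (auto simp: zmult_eq_neg1_iff)
  then have "int n dvd v \<and> int n dvd j"
  proof
    assume *: "a0 = a1 + 1 \<and> b1 = b0 + 1"
    then have "(k + 1) div 2 = a0" "(l + 1) div 2 = b1" using kl by simp_all
    then have "coprime (int n) (int a0)" "coprime (int n) (int b1)"
      using assms(16,17) by (simp_all add: coprime_iff_gcd_eq_1)
    then have "int n dvd v" "int n dvd j + \<sigma> * v"
      using da0 db1 by (simp_all add: coprime_dvd_mult_left_iff)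
    then show ?thesis by (metis dvd_add_left_iff dvd_mult)
  next
    assume *: "a1 = a0 + 1 \<and> b0 = b1 + 1"
    then have "(k + 1) div 2 = a1" "(l + 1) div 2 = b0" using kl by simp_all
    then have "coprime (int n) (int a1)" "coprime (int n) (int b0)"
      using assms(16,17) by (simp_all add: coprime_iff_gcd_eq_1)
    then have "int n dvd v" "int n dvd \<sigma> * j + v"
      using da1 db0 by (simp_all add: coprime_dvd_mult_left_iff)
    then show ?thesis using \<sigma> by (auto simp: dvd_add_left_iff)
  qed
  then have vj: "v = 0" "j = 0"
    using v assms(8,9) by (auto dest: zdvd_imp_le)
  let ?F = "\<lambda>(s, t). ((s + u) mod 2, (i * t) mod int n)"
  have "C' = (\<lambda>(s, t). ((s + u) mod 2, (\<sigma> * i * t) mod int n)) ` A'"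
    by (simp add: C' vj)
  then have C'': "C' = ?F ` A'"
    using strongly_symmetric_image_sign[OF n A', of u i] \<sigma> by (elim disjE) simp_all
  have "d s = 0" for s by (simp add: d_def vj)
  then have D'': "D' = ?F ` B'" by (simp add: D')
  \<comment> \<open>\<open>i\<close> may be even; only its residue modulo \<open>n\<close> matters, and a unit modulo \<open>2 n\<close> is needed.\<close>
  define m where "m = (if odd i then i else i + int n)"
  have m: "odd m" "m mod int n = i mod int n" using assms(2) by (simp_all add: m_def)
  have "coprime m (int n)"
    using ci m(2) by (metis coprime_mod_left_iff n of_nat_0_less_iff less_irrefl)
  then have cm: "coprime m (int (2 * n))" using m(1) by simp
  let ?G = "integer_mod_group (2 * n)"
  let ?g = "\<lambda>x. (m * x) mod int (2 * n)"
  let ?w = "u * int n"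
  have w: "?w \<in> carrier ?G" using u n by (auto simp: carrier_integer_mod_group)
  have inv_w: "inv\<^bsub>?G\<^esub> ?w = ?w"
    using u w n by (auto simp: zmod_zminus1_eq_if)
  have AB: "A = inv_pecher_set n A'" "B = inv_pecher_set n B'"
    "C = inv_pecher_set n C'" "D = inv_pecher_set n D'"
    using assms(18,19) by (simp_all add: inv_pecher_def)
  have "C = ?g ` A #>\<^bsub>?G\<^esub> ?w"
    unfolding AB C'' inv_pecher_set_affine[OF assms(2) A'(1) m]
    by (auto simp: r_coset_def mult_integer_mod_group mod_simps)
  moreover have "D = inv\<^bsub>?G\<^esub> ?w <#\<^bsub>?G\<^esub> ?g ` B"
    unfolding AB D'' inv_pecher_set_affine[OF assms(2) B'(1) m] inv_w
    by (auto simp: l_coset_def mult_integer_mod_group mod_simps add.commute)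
  moreover have "?g \<in> iso ?G ?G"
    using integer_mod_group_mult_iso[OF _ cm] n by simp
  ultimately have "equivalent_nf ?G A B C D"
    unfolding equivalent_nf_def using w by (intro bexI[of _ ?g] bexI[of _ ?w] conjI)
  moreover have "symmetric_nf ?G A B" "symmetric_nf ?G C D"
    unfolding AB by (rule symmetric_nf_inv_pecher_set[OF assms(2,3)]
      symmetric_nf_inv_pecher_set[OF assms(2,6)])+
  ultimately show ?thesis by blast
qed

end
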